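(* For every integer $n\geq 1$ and every real number $q\neq 1$, $$\mathfrak{N}_n(q)=(q-1)^{n+1}\int_{0}^{\frac{q}{q-1}}P_n(2x-1)\,dx = q(q-1)^{n}\int_{0}^{1}P_n\!\left(\frac{2q}{q-1}x-1\right)dx.$$
   Context: For $n\ge 1$ the Narayana polynomial is $\mathfrak{N}_n(q)=\sum_{k=1}^n\frac{1}{n}\binom{n}{k-1}\binom{n}{k}q^{k}$. $P_n$ denotes the $n$-th Legendre polynomial, $P_n(x)=2^{-n}\sum_{k=0}^{\lfloor n/2\rfloor}(-1)^k\binom{n-k}{k}\binom{2n-2k}{n-k}x^{n-2k}$. *)

theory Defs
  imports "HOL-Analysis.Analysis" "HOL-Computational_Algebra.Polynomial"
begin

definition narayana_poly :: "nat \<Rightarrow> real poly" where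
  "narayana_poly n =
     (\<Sum>k = 1..n. monom (1 / real n * real (n choose (k - 1)) * real (n choose k)) k)"

text \<open>No truncation occurs in the natural number subtractions, since \<open>k \<le> n div 2\<close> throughout.\<close>

definition legendre_poly :: "nat \<Rightarrow> real poly" where
  "legendre_poly n =
     smult (1 / 2 ^ n)
       (\<Sum>k = 0..n div 2.
          monom ((-1) ^ k * real ((n - k) choose k) * real ((2 * n - 2 * k) choose (n - k)))
                (n - 2 * k))"

end

(* The coefficient of t^n in (t + x - 1)^n (t + x)^n = ((t + y/2)^2 - 1/4)^n, where y = 2x - 1,
   gives P_n(2x - 1) = sum_k (n choose k)^2 x^k (x - 1)^(n - k).  This sum is the derivative of
   F(x) = sum_k N(n, k) x^k (x - 1)^(n + 1 - k) with N(n, k) the Narayana numbers,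
   and F(q / (q - 1)) (q - 1)^(n + 1) is the Narayana polynomial at q. *)
theory Submission
  imports Defs
begin

text \<open>For \<open>i > m\<close> both sides vanish. This case is needed in
  \<open>coeff_square_minus_power\<close>, where the exponent \<open>2 * n - 2 * k\<close> can drop
  below \<open>n\<close>.\<close>

lemma coeff_linear_power_1:
  fixes a :: "'a::comm_semiring_1"
  shows "coeff ([:a, 1:] ^ m) i = of_nat (m choose i) * a ^ (m - i)"
proof (cases "i \<le> m")
  case False
  then have "degree ([:a, 1:] ^ m) < i"
    by (simp add: degree_linear_power)
  with False show ?thesis
    by (simp add: coeff_eq_0 binomial_eq_0)
qed (simp add: coeff_linear_poly_power)

lemma coeff_linear_power_mult:
  fixes a b :: "'a::comm_semiring_1"
  shows "coeff ([:a, 1:] ^ n * [:b, 1:] ^ n) n = (\<Sum>k\<le>n. of_nat ((n choose k)\<^sup>2) * b ^ k * a ^ (n - k))"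
  unfolding coeff_mult
proof (rule sum.cong)
  fix k assume "k \<in> {..n}"
  then show "coeff ([:a, 1:] ^ n) k * coeff ([:b, 1:] ^ n) (n - k)
      = of_nat ((n choose k)\<^sup>2) * b ^ k * a ^ (n - k)"
    by (simp add: coeff_linear_power_1 binomial_symmetric[of k n] power2_eq_square mult_ac)
qed simp

text \<open>Binomial expansion in the constant \<open>- d\<close> leaves only even powers of the
  linear factor, each with a known coefficient of t^n. Once 2k > n,
  \<open>(2 * n - 2 * k) choose n\<close> is 0, so the truncated exponent \<open>n - 2 * k\<close>
  does no harm.\<close>

lemma coeff_square_minus_power:
  fixes a d :: "'a::comm_ring_1"
  shows "coeff (([:a, 1:]\<^sup>2 - [:d:]) ^ n) n
    = (\<Sum>k\<le>n. (- d) ^ k * of_nat (n choose k) * of_nat ((2 * n - 2 * k) choose n) * a ^ (n - 2 * k))"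
proof -
  have "([:a, 1:]\<^sup>2 - [:d:]) ^ n = ([:- d:] + [:a, 1:]\<^sup>2) ^ n"
    by (simp only: diff_conv_add_uminus minus_pCons minus_zero add.commute)
  also have "\<dots> = (\<Sum>k\<le>n. of_nat (n choose k) * [:- d:] ^ k * ([:a, 1:]\<^sup>2) ^ (n - k))"
    by (rule binomial_ring)
  also have "\<dots> = (\<Sum>k\<le>n. smult ((- d) ^ k * of_nat (n choose k)) ([:a, 1:] ^ (2 * n - 2 * k)))"
    by (intro sum.cong refl)
      (simp add: poly_const_pow of_nat_poly mult.commute diff_mult_distrib flip: power_mult)
  finally have *: "([:a, 1:]\<^sup>2 - [:d:]) ^ n
      = (\<Sum>k\<le>n. smult ((- d) ^ k * of_nat (n choose k)) ([:a, 1:] ^ (2 * n - 2 * k)))" .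
  have "2 * n - 2 * k - n = n - 2 * k" for k by simp
  then show ?thesis
    unfolding * by (simp add: coeff_sum coeff_linear_power_1 mult.assoc)
qed

text \<open>Both sides equal (2n-2k)! / (k! (n-k)! (n-2k)!). The left is the coefficient in the
  definition of P_n, the right the one from the binomial expansion.\<close>

lemma legendre_coeff_eq:
  assumes "2 * k \<le> n"
  shows "((n - k) choose k) * ((2 * n - 2 * k) choose (n - k))
    = (n choose k) * ((2 * n - 2 * k) choose n)"
proof -
  have "((2 * n - 2 * k) choose n) * (n choose (n - k))
      = ((2 * n - 2 * k) choose (n - k)) * ((2 * n - 2 * k - (n - k)) choose (n - (n - k)))"
    using assms by (intro choose_mult) auto
  moreover have "2 * n - 2 * k - (n - k) = n - k" "n - (n - k) = k"
    using assms by auto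
  moreover have "n choose (n - k) = n choose k"
    using assms binomial_symmetric[of k n] by simp
  ultimately show ?thesis
    by (simp add: mult.commute)
qed

text \<open>Rodrigues' formula in coefficient form: P_n(y) is 2^(-n) times the coefficient of s^n in
  ((y + s)^2 - 1)^n, rescaled by s = 2t.\<close>

lemma poly_legendre_eq_coeff:
  "poly (legendre_poly n) y = coeff (([:y / 2, 1:]\<^sup>2 - [:1 / 4:]) ^ n) n"
proof -
  have "poly (legendre_poly n) y
      = (\<Sum>k = 0..n div 2. 1 / 2 ^ n * ((-1) ^ k * real ((n - k) choose k)
          * real ((2 * n - 2 * k) choose (n - k)) * y ^ (n - 2 * k)))"
    unfolding legendre_poly_def by (simp add: poly_sum poly_monom sum_distrib_left)
  also have "\<dots> = (\<Sum>k = 0..n div 2. (- (1 / 4)) ^ k * real (n choose k)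
      * real ((2 * n - 2 * k) choose n) * (y / 2) ^ (n - 2 * k))"
  proof (rule sum.cong)
    fix k assume "k \<in> {0..n div 2}"
    then have k: "2 * k \<le> n" by auto
    \<comment> \<open>The prefactor 2^(-n) splits into 4^(-k), absorbed by the powers of -1/4, and
      2^(-(n-2k)), absorbed by those of y/2.\<close>
    have "(2::real) ^ n = 2 ^ (2 * k) * 2 ^ (n - 2 * k)"
      using k by (simp flip: power_add)
    then have pow: "(2::real) ^ n = 4 ^ k * 2 ^ (n - 2 * k)"
      by (simp add: power_mult)
    have "real ((n - k) choose k) * real ((2 * n - 2 * k) choose (n - k))
        = real (n choose k) * real ((2 * n - 2 * k) choose n)"
      using legendre_coeff_eq[OF k] by (metis of_nat_mult)
    moreover have "(- (1 / 4 :: real)) ^ k = (-1) ^ k / 4 ^ k"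
      by (metis minus_divide_left power_divide)
    ultimately show "1 / 2 ^ n * ((-1) ^ k * real ((n - k) choose k)
          * real ((2 * n - 2 * k) choose (n - k)) * y ^ (n - 2 * k))
        = (- (1 / 4)) ^ k * real (n choose k)
          * real ((2 * n - 2 * k) choose n) * (y / 2) ^ (n - 2 * k)"
      by (simp add: pow power_divide mult.assoc)
  qed simp
  also have "\<dots> = (\<Sum>k\<le>n. (- (1 / 4)) ^ k * real (n choose k)
      * real ((2 * n - 2 * k) choose n) * (y / 2) ^ (n - 2 * k))"
    \<comment> \<open>The added terms have 2k > n, hence 2n - 2k < n and a zero binomial.\<close>
    by (intro sum.mono_neutral_left) (auto simp: binomial_eq_0)
  finally show ?thesis
    by (simp add: coeff_square_minus_power)
qed

lemma poly_legendre_shifted: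
  "poly (legendre_poly n) (2 * x - 1) = (\<Sum>k\<le>n. real ((n choose k)\<^sup>2) * x ^ k * (x - 1) ^ (n - k))"
proof -
  have "[:(2 * x - 1) / 2, 1:]\<^sup>2 - [:1 / 4:] = [:x - 1, 1:] * [:x, 1:]"
    by (simp add: power2_eq_square field_simps)
  then show ?thesis
    by (simp only: poly_legendre_eq_coeff power_mult_distrib coeff_linear_power_mult)
qed

text \<open>Indexed by j = k - 1. Every term contains a factor x, so this antiderivative vanishes at
  0 and its values are the integrals from 0.\<close>

definition narayana_antideriv :: "nat \<Rightarrow> real \<Rightarrow> real" where
  "narayana_antideriv n x =
     (\<Sum>j<n. real (n choose j) * real (n choose Suc j) / real n * x ^ Suc j * (x - 1) ^ (n - j))"

lemma narayana_antideriv_0 [simp]: "narayana_antideriv n 0 = 0"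
  by (simp add: narayana_antideriv_def)

text \<open>By the product rule, term j contributes (n-j)/n of \<open>c j\<close> and (j+1)/n of
  \<open>c (Suc j)\<close>. Each \<open>c k\<close> thus collects total weight (n-k)/n + k/n =
  1.\<close>

lemma has_real_derivative_narayana_antideriv:
  assumes "n \<ge> 1"
  shows "(narayana_antideriv n has_real_derivative poly (legendre_poly n) (2 * x - 1)) (at x within S)"
proof -
  define c where "c k = real ((n choose k)\<^sup>2) * x ^ k * (x - 1) ^ (n - k)" for k
  let ?b = "\<lambda>j. real (n choose j) * real (n choose Suc j) / real n"
  \<comment> \<open>Both sides equal n times (n-1 choose j). This turns the mixed products of
    binomials into squares.\<close>
  have absorb: "real (Suc j) * real (n choose Suc j) = real (n - j) * real (n choose j)" for j
    by (metis binomial_absorb_comp binomial_absorption of_nat_mult)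
  have 1: "?b j * (real (Suc j) * x ^ j) * (x - 1) ^ (n - j) = c j * real (n - j) / real n" for j
  proof -
    have "?b j * (real (Suc j) * x ^ j) * (x - 1) ^ (n - j)
        = real (n choose j) * (real (Suc j) * real (n choose Suc j)) * x ^ j * (x - 1) ^ (n - j) / real n"
      by (simp add: mult_ac del: of_nat_Suc)
    then show ?thesis
      unfolding absorb by (simp add: c_def power2_eq_square mult_ac)
  qed
  have 2: "?b j * x ^ Suc j * (real (n - j) * (x - 1) ^ (n - Suc j)) = c (Suc j) * real (Suc j) / real n" for j
  proof -
    have "?b j * x ^ Suc j * (real (n - j) * (x - 1) ^ (n - Suc j))
        = real (n choose Suc j) * (real (n - j) * real (n choose j)) * x ^ Suc j * (x - 1) ^ (n - Suc j) / real n"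
      by (simp add: mult_ac)
    then show ?thesis
      unfolding absorb[symmetric] by (simp add: c_def power2_eq_square mult_ac del: of_nat_Suc)
  qed
  have "(narayana_antideriv n has_real_derivative
      (\<Sum>j<n. ?b j * (real (Suc j) * x ^ j) * (x - 1) ^ (n - j)
        + ?b j * x ^ Suc j * (real (n - j) * (x - 1) ^ (n - Suc j)))) (at x within S)"
    unfolding narayana_antideriv_def
    by (auto intro!: derivative_eq_intros sum.cong simp del: of_nat_Suc power_Suc
        simp: mult_ac add_divide_distrib distrib_left)
  also have "(\<Sum>j<n. ?b j * (real (Suc j) * x ^ j) * (x - 1) ^ (n - j)
        + ?b j * x ^ Suc j * (real (n - j) * (x - 1) ^ (n - Suc j)))
      = (\<Sum>j<n. c j * real (n - j) / real n) + (\<Sum>j<n. c (Suc j) * real (Suc j) / real n)"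
    unfolding 1 2 by (rule sum.distrib)
  \<comment> \<open>Both sums are brought to the range 0..n: the new term k = n has weight 0 here,
    and k = 0 has weight 0 in the shifted sum.\<close>
  also have "(\<Sum>j<n. c j * real (n - j) / real n) = (\<Sum>k<Suc n. c k * real (n - k) / real n)"
    by simp
  also have "(\<Sum>j<n. c (Suc j) * real (Suc j) / real n) = (\<Sum>k<Suc n. c k * real k / real n)"
    by (subst sum.lessThan_Suc_shift) simp
  also have "(\<Sum>k<Suc n. c k * real (n - k) / real n) + (\<Sum>k<Suc n. c k * real k / real n)
      = (\<Sum>k<Suc n. c k)"
    unfolding sum.distrib[symmetric]
  proof (rule sum.cong)
    fix k assume "k \<in> {..<Suc n}"
    with assms show "c k * real (n - k) / real n + c k * real k / real n = c k"
      by (simp add: of_nat_diff field_simps)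
  qed simp
  also have "\<dots> = poly (legendre_poly n) (2 * x - 1)"
    unfolding poly_legendre_shifted c_def lessThan_Suc_atMost ..
  finally show ?thesis .
qed

text \<open>At x = q/(q-1) one has x - 1 = 1/(q-1). Each term is homogeneous of degree n + 1 in x
  and x - 1, so the prefactor clears all denominators and leaves q^(j+1).\<close>

lemma poly_narayana_eq_antideriv:
  assumes "q \<noteq> 1"
  shows "poly (narayana_poly n) q = (q - 1) ^ (n + 1) * narayana_antideriv n (q / (q - 1))"
proof -
  have "poly (narayana_poly n) q
      = (\<Sum>k = 1..n. 1 / real n * real (n choose (k - 1)) * real (n choose k) * q ^ k)"
    by (simp add: narayana_poly_def poly_sum poly_monom)
  also have "\<dots> = (\<Sum>j<n. real (n choose j) * real (n choose Suc j) / real n * q ^ Suc j)"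
    by (rule sum.reindex_bij_witness[of _ Suc "\<lambda>k. k - 1"]) auto
  also have "\<dots> = (\<Sum>j<n. (q - 1) ^ (n + 1) * (real (n choose j) * real (n choose Suc j) / real n
      * (q / (q - 1)) ^ Suc j * (q / (q - 1) - 1) ^ (n - j)))"
  proof (rule sum.cong)
    fix j assume "j \<in> {..<n}"
    then have "(q - 1) ^ (n + 1) = (q - 1) ^ Suc j * (q - 1) ^ (n - j)"
      by (simp flip: power_add)
    moreover have "q / (q - 1) - 1 = 1 / (q - 1)"
      using assms by (simp add: field_simps)
    ultimately have "(q - 1) ^ (n + 1) * ((q / (q - 1)) ^ Suc j * (q / (q - 1) - 1) ^ (n - j)) = q ^ Suc j"
      using assms by (simp add: power_divide del: power_Suc)
    then show "real (n choose j) * real (n choose Suc j) / real n * q ^ Suc j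
        = (q - 1) ^ (n + 1) * (real (n choose j) * real (n choose Suc j) / real n
          * (q / (q - 1)) ^ Suc j * (q / (q - 1) - 1) ^ (n - j))"
      by (metis mult.assoc mult.left_commute)
  qed simp
  finally show ?thesis
    by (simp add: narayana_antideriv_def sum_distrib_left)
qed

text \<open>Substitution x -> c x. The integral is oriented, so \<open>c\<close> may be zero or
  negative, as q/(q-1) is for 0 < q < 1.\<close>

lemma interval_integral_scale:
  fixes f :: "real \<Rightarrow> real" and c :: real
  assumes "continuous_on UNIV f"
  shows "(LBINT x=0..c. f x) = c * (LBINT x=0..1. f (c * x))"
proof -
  have "(LBINT x=ereal 0..ereal 1. c *\<^sub>R f (c * x)) = (LBINT x=ereal (c * 0)..ereal (c * 1). f x)"
    using assms
    by (intro interval_integral_substitution_finite)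
      (auto intro!: derivative_eq_intros intro: continuous_on_subset)
  then show ?thesis
    by (simp add: zero_ereal_def one_ereal_def)
qed

theorem theorem2p1:
  fixes n :: nat and q :: real
  assumes "n \<ge> 1" and "q \<noteq> 1"
  shows "poly (narayana_poly n) q
           = (q - 1) ^ (n + 1) * (LBINT x=0..q / (q - 1). poly (legendre_poly n) (2 * x - 1))
       \<and> (q - 1) ^ (n + 1) * (LBINT x=0..q / (q - 1). poly (legendre_poly n) (2 * x - 1))
           = q * (q - 1) ^ n * (LBINT x=0..1. poly (legendre_poly n) (2 * q / (q - 1) * x - 1))"
proof -
  let ?f = "\<lambda>x. poly (legendre_poly n) (2 * x - 1)"
  let ?c = "q / (q - 1)"
  have cont: "continuous_on S ?f" for S
    by (intro continuous_intros)
  have "(LBINT x=ereal 0..ereal ?c. ?f x) = narayana_antideriv n ?c - narayana_antideriv n 0"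
    using has_real_derivative_narayana_antideriv[OF assms(1)]
    by (intro interval_integral_FTC_finite cont)
      (simp flip: has_real_derivative_iff_has_vector_derivative)
  then have "(LBINT x=0..?c. ?f x) = narayana_antideriv n ?c"
    by (simp add: zero_ereal_def)
  moreover have "(q - 1) ^ (n + 1) * (LBINT x=0..?c. ?f x)
      = q * (q - 1) ^ n * (LBINT x=0..1. poly (legendre_poly n) (2 * q / (q - 1) * x - 1))"
    \<comment> \<open>The scaling factor q/(q-1) cancels one power of q - 1.\<close>
    using assms(2) by (simp add: interval_integral_scale[OF cont] mult.assoc)
  ultimately show ?thesis
    using poly_narayana_eq_antideriv[OF assms(2)] by simp
qed

end
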